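(* Subcarriers are assigned randomly and sequentially to secondary users (SUs) $1,2,\dots,m$ in the presence of $N$ primary users (PUs), preserving the orthogonality between the SUs' subcarriers, as described in the context; $\mathbf k_j=(k_{1j},\dots,k_{Nj},k_{fj})^{\mathrm T}$ denotes the vector of numbers of collisions of SU $j$ with each of the $N$ PUs and of its collision-free subcarriers. Then the PMF of the number of subcarrier collisions for the $m$th SU is $$p(\mathbf k_m)=\sum_{\mathbf k_1}\sum_{\mathbf k_2}\cdots\sum_{\mathbf k_{m-1}}p(\mathbf k_1,\mathbf k_2,\dots,\mathbf k_m),$$ where the joint PMF is $$p(\mathbf k_1,\dots,\mathbf k_m)=\left[\binom{F_f}{k_{f1}}\binom{F}{F_1^S}^{-1}\prod_{n=1}^N\binom{F_n^P}{k_{n1}}\right]\prod_{r=2}^m\left\{\binom{F_f-\sum_{j=1}^{r-1}k_{fj}}{k_{fr}}\binom{F-\mathbf 1^{\mathrm T}\left(\sum_{j=1}^{r-1}\mathbf k_j\right)}{F_r^S}^{-1}\prod_{n=1}^N\binom{F_n^P-\sum_{j=1}^{r-1}k_{nj}}{k_{nr}}\right\}.$$ The mean and support of $k_{nm}$ are given, respectively, by $$\mathbb{E}[k_{nm}]=\frac{F_m^S\left(F_n^P-\sum_{j=1}^{m-1}\mathbb{E}[k_{nj}]\right)}{F-\sum_{j=1}^{m-1}F_j^S}$$ and $$\left\{\mathbf k_m:\ \sum_{n=1}^Nk_{nm}+k_{fm}=F_m^S\ \text{ and }\ k_{nm}\in\Bigl[\Bigl(F_m^S+F_n^P-\sum_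{j=1}^{m-1}k_{nj}-F\Bigr)^+,\dots,\min\Bigl\{F_m^S,\;F_n^P-\sum_{j=1}^{m-1}k_{nj}\Bigr\}\Bigr]\right\}.$$
   Context: There are $F$ subcarriers; PUs $n=1,\dots,N$ use pairwise disjoint fixed sets of $F_n^P$ subcarriers, and the remaining $F_f=F-\sum_{n=1}^NF_n^P$ subcarriers are free. Sequential random assignment: SU $1$ gets a uniformly random set of $F_1^S$ of the $F$ subcarriers; these are removed; then SU $2$ gets a uniformly random set of $F_2^S$ of the remaining subcarriers; these are removed; and so on, so that SU $r$ gets a uniformly random $F_r^S$-element subset of the subcarriers not assigned to SUs $1,\dots,r-1$. For each SU $j$, $k_{nj}$ is the number of its subcarriers that are used by PU $n$, and $k_{fj}$ the number that are free of PUs, so $\sum_nk_{nj}+k_{fj}=F_j^S$. Notation: $\mathbf 1=(1,\dots,1)^{\mathrm T}\in\mathbb Z^{N+1}$, so $\mathbf 1^{\mathrm T}\mathbf k_j=F_j^S$; $(x)^+=\max\{0,x\}$; $[a,\dots,b]$ denotes the integers from $a$ to $b$; $\binom ab$ is the binomial coefficient; sums over $\mathbf k_j$ run over the possible values of $\mathbf k_j$.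
   Formalization: The support, read as that of k_m given k_1,…,k_{m-1}, is proved to be the displayed set with the added constraint k_fm + sum_{j<m} k_fj ≤ F_f; without it the claim fails, e.g. m=1, N=2, F=2, F_1^P=F_2^P=1, F_1^S=1 at (0,0,1). *)

theory Defs
  imports "HOL-Probability.Probability"
begin

text \<open>
  Sequential random assignment of the subcarriers in \<open>A\<close>: SU \<open>r\<close> receives a uniformly random
  \<open>s r\<close>-element subset of the subcarriers not held by SUs \<open>1, \<dots>, r - 1\<close>. An outcome \<open>X\<close> maps each
  SU to its set of subcarriers. Since \<open>pmf_of_set\<close> is unspecified on the empty set, this is
  meaningful only if \<open>s 1 + \<dots> + s m \<le> card A\<close>.
\<close>

primrec assignment :: "'a set \<Rightarrow> (nat \<Rightarrow> nat) \<Rightarrow> nat \<Rightarrow> (nat \<Rightarrow> 'a set) pmf" where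
  "assignment A s 0 = return_pmf (\<lambda>_. {})"
| "assignment A s (Suc r) =
     bind_pmf (assignment A s r) (\<lambda>X.
       map_pmf (\<lambda>T. X(Suc r := T))
         (pmf_of_set {T. T \<subseteq> A - (\<Union>j\<in>{1..r}. X j) \<and> card T = s (Suc r)}))"

text \<open>
  Vectors of length \<open>N + 1\<close> are extensional functions on \<open>{1..N+1}\<close>; coordinate \<open>n \<le> N\<close> counts the
  collisions with PU \<open>n\<close>, coordinate \<open>N + 1\<close> the collision-free subcarriers.
\<close>

definition vecs :: "nat \<Rightarrow> (nat \<Rightarrow> nat) set" where
  "vecs N = {1..N+1} \<rightarrow>\<^sub>E UNIV"

definition collisions :: "(nat \<Rightarrow> 'a set) \<Rightarrow> nat \<Rightarrow> 'a set \<Rightarrow> nat \<Rightarrow> nat" where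
  "collisions P N T = (\<lambda>i\<in>{1..N+1}.
     if i \<le> N then card (T \<inter> P i) else card (T - (\<Union>n\<in>{1..N}. P n)))"

definition collision_pmf ::
  "'a set \<Rightarrow> (nat \<Rightarrow> 'a set) \<Rightarrow> nat \<Rightarrow> (nat \<Rightarrow> nat) \<Rightarrow> nat \<Rightarrow> nat \<Rightarrow> (nat \<Rightarrow> nat) pmf" where
  "collision_pmf A P N s m j = map_pmf (\<lambda>X. collisions P N (X j)) (assignment A s m)"

definition joint_collision_pmf ::
  "'a set \<Rightarrow> (nat \<Rightarrow> 'a set) \<Rightarrow> nat \<Rightarrow> (nat \<Rightarrow> nat) \<Rightarrow> nat \<Rightarrow> (nat \<Rightarrow> nat \<Rightarrow> nat) pmf" where
  "joint_collision_pmf A P N s m =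
     map_pmf (\<lambda>X. \<lambda>j\<in>{1..m}. collisions P N (X j)) (assignment A s m)"

text \<open>
  The law of the collision vector of SU \<open>m\<close> conditioned on SUs \<open>1, \<dots>, m - 1\<close> having the collision
  vectors \<open>h 1, \<dots>, h (m - 1)\<close>; meaningful only if that event has positive probability.
\<close>

definition cond_collision_pmf ::
  "'a set \<Rightarrow> (nat \<Rightarrow> 'a set) \<Rightarrow> nat \<Rightarrow> (nat \<Rightarrow> nat) \<Rightarrow> nat \<Rightarrow> (nat \<Rightarrow> nat \<Rightarrow> nat)
     \<Rightarrow> (nat \<Rightarrow> nat) pmf" where
  "cond_collision_pmf A P N s m h =
     map_pmf (\<lambda>X. collisions P N (X m))
       (cond_pmf (assignment A s m) {X. \<forall>j\<in>{1..<m}. collisions P N (X j) = h j})"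

end

theory Submission
  imports Defs
begin

text \<open>
  The PUs together with the free subcarriers partition \<open>A\<close>, so the free class is just one more
  colour and all coordinates of a collision vector behave alike. Given the sets of the first \<open>r\<close>
  SUs, the number of admissible choices for SU \<open>r + 1\<close> with a prescribed vector is a product of
  binomials that depends on the past only through the previous collision vectors. Hence the
  probability of a sequence of vectors multiplies step by step, and a vector has positive
  conditional probability iff no colour is overdrawn. For the mean, a uniformly random
  \<open>s\<close>-subset of \<open>R\<close> meets \<open>Q \<subseteq> R\<close> in \<open>s * card Q / card R\<close> elements on average; this is affine in
  the earlier collision numbers, so taking expectations over the past preserves its form.
\<close>

section \<open>Counting subsets by their intersections with given sets\<close>

text \<open>Cutting \<open>T\<close> along disjoint blocks is a bijection onto families of traces
  chosen independently in each block; taking the union is the inverse.\<close>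

lemma card_subsets_with_profile:
  assumes "finite I" and "disjoint_family_on B I" and "\<And>i. i \<in> I \<Longrightarrow> finite (B i)"
  shows "card {T. T \<subseteq> (\<Union>i\<in>I. B i) \<and> (\<forall>i\<in>I. card (T \<inter> B i) = k i)}
    = (\<Prod>i\<in>I. card (B i) choose k i)"
proof -
  let ?S = "{T. T \<subseteq> (\<Union>i\<in>I. B i) \<and> (\<forall>i\<in>I. card (T \<inter> B i) = k i)}"
  let ?C = "\<lambda>i. {U. U \<subseteq> B i \<and> card U = k i}"
  have sub: "f i \<subseteq> B i" "card (f i) = k i" if "f \<in> Pi\<^sub>E I ?C" "i \<in> I" for f i
    using PiE_mem[OF that] by auto
  have part: "(\<Union>i\<in>I. f i) \<inter> B j = f j" if f: "f \<in> Pi\<^sub>E I ?C" and j: "j \<in> I" for f j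
  proof -
    have "f i \<inter> B j = {}" if "i \<in> I" "i \<noteq> j" for i
      using sub(1)[OF f that(1)] disjoint_family_onD[OF assms(2) that(1) j that(2)] by blast
    thus ?thesis using sub(1)[OF f j] j by blast
  qed
  have "bij_betw (\<lambda>T. \<lambda>i\<in>I. T \<inter> B i) ?S (Pi\<^sub>E I ?C)"
  proof (rule bij_betw_byWitness[where f' = "\<lambda>f. \<Union>i\<in>I. f i"])
    show "\<forall>f\<in>Pi\<^sub>E I ?C. (\<lambda>i\<in>I. (\<Union>j\<in>I. f j) \<inter> B i) = f"
    proof
      fix f assume f: "f \<in> Pi\<^sub>E I ?C"
      show "(\<lambda>i\<in>I. (\<Union>j\<in>I. f j) \<inter> B i) = f"
        using part[OF f] PiE_arb[OF f] by (simp add: fun_eq_iff restrict_def)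
    qed
    show "(\<lambda>f. \<Union>i\<in>I. f i) ` Pi\<^sub>E I ?C \<subseteq> ?S"
    proof (rule image_subsetI)
      fix f assume f: "f \<in> Pi\<^sub>E I ?C"
      have "(\<Union>i\<in>I. f i) \<subseteq> (\<Union>i\<in>I. B i)"
        by (rule UN_mono) (use sub(1)[OF f] in auto)
      thus "(\<Union>i\<in>I. f i) \<in> ?S"
        using part[OF f] sub(2)[OF f] by simp
    qed
    show "\<forall>T\<in>?S. (\<Union>i\<in>I. (\<lambda>i\<in>I. T \<inter> B i) i) = T" by auto
    show "(\<lambda>T. \<lambda>i\<in>I. T \<inter> B i) ` ?S \<subseteq> Pi\<^sub>E I ?C" by auto
  qed
  hence "card ?S = card (Pi\<^sub>E I ?C)"
    by (rule bij_betw_same_card)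
  also have "\<dots> = (\<Prod>i\<in>I. card (B i) choose k i)"
    using assms by (simp add: card_PiE n_subsets)
  finally show ?thesis .
qed

text \<open>This is the hypergeometric mean, by double counting pairs
  \<open>x \<in> T \<inter> Q\<close>: every \<open>x\<close> lies in equally many
  \<open>s\<close>-subsets, and the absorption identity for binomials turns that number into the
  fraction \<open>s / card R\<close> of all of them.\<close>

lemma sum_card_Int_subsets:
  assumes R: "finite R" and Q: "Q \<subseteq> R" and s: "s \<le> card R"
  shows "(\<Sum>T | T \<subseteq> R \<and> card T = s. real (card (T \<inter> Q))) / real (card R choose s)
    = real s * real (card Q) / real (card R)"
proof (cases s)
  case 0
  have "(\<Sum>T | T \<subseteq> R \<and> card T = s. real (card (T \<inter> Q))) = 0"
    using finite_subset[OF _ R] 0 by (intro sum.neutral) auto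
  thus ?thesis by (simp add: 0)
next
  case (Suc t)
  let ?S = "{T. T \<subseteq> R \<and> card T = s}"
  have finS: "finite ?S" and finQ: "finite Q"
    using R finite_subset[OF Q] by auto
  \<comment> \<open>Removing \<open>x\<close> leaves an arbitrary \<open>t\<close>-subset of
    \<open>R - {x}\<close>, where \<open>t = s - 1\<close>; this is why \<open>s = 0\<close> was
    split off.\<close>
  have "card {T \<in> ?S. x \<in> T} = (card R - 1) choose t" if "x \<in> Q" for x
  proof -
    have "x \<in> R" using that Q by blast
    have "bij_betw (insert x) {U. U \<subseteq> R - {x} \<and> card U = t} {T \<in> ?S. x \<in> T}"
    proof (rule bij_betw_byWitness[where f' = "\<lambda>T. T - {x}"])
      show "insert x ` {U. U \<subseteq> R - {x} \<and> card U = t} \<subseteq> {T \<in> ?S. x \<in> T}"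
      proof (rule image_subsetI)
        fix U assume "U \<in> {U. U \<subseteq> R - {x} \<and> card U = t}"
        moreover from this have "finite U" "x \<notin> U"
          using finite_subset[OF _ R, of U] by auto
        ultimately show "insert x U \<in> {T \<in> ?S. x \<in> T}"
          using \<open>x \<in> R\<close> Suc by auto
      qed
      show "(\<lambda>T. T - {x}) ` {T \<in> ?S. x \<in> T} \<subseteq> {U. U \<subseteq> R - {x} \<and> card U = t}"
        using Suc by auto
    qed auto
    hence "card {T \<in> ?S. x \<in> T} = card {U. U \<subseteq> R - {x} \<and> card U = t}"
      by (rule bij_betw_same_card[symmetric])
    thus ?thesis
      using R \<open>x \<in> R\<close> by (simp add: n_subsets)
  qed
  hence "(\<Sum>T\<in>?S. card {x \<in> Q. x \<in> T}) = ((card R - 1) choose t) * card Q"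
    using sum_multicount[OF finS finQ, of "\<lambda>T x. x \<in> T"] by simp
  moreover have "{x \<in> Q. x \<in> T} = T \<inter> Q" for T by auto
  ultimately have "(\<Sum>T\<in>?S. card (T \<inter> Q)) = ((card R - 1) choose t) * card Q"
    by simp
  hence eq: "(\<Sum>T\<in>?S. real (card (T \<inter> Q))) = real ((card R - 1) choose t) * real (card Q)"
    by (simp flip: of_nat_sum of_nat_mult)
  have "s * (card R choose s) = card R * ((card R - 1) choose t)"
    using times_binomial_minus1_eq[of s "card R"] by (simp add: Suc)
  hence "real s * real (card R choose s) = real (card R) * real ((card R - 1) choose t)"
    by (simp flip: of_nat_mult)
  moreover have "card R choose s > 0" "card R > 0"
    using s Suc by auto
  ultimately show ?thesis
    unfolding eq by (simp add: field_simps)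
qed

text \<open>The additive form avoids truncated subtraction and yields both the size of what remains
  and the fact that no more than \<open>card Q\<close> elements were removed.\<close>

lemma card_Diff_UN_disjoint:
  assumes "finite Q" and "finite J" and "disjoint_family_on X J"
  shows "card (Q - (\<Union>j\<in>J. X j)) + (\<Sum>j\<in>J. card (X j \<inter> Q)) = card Q"
proof -
  have "card (\<Union>j\<in>J. X j \<inter> Q) = (\<Sum>j\<in>J. card (X j \<inter> Q))"
    using assms by (intro card_UN_disjoint') (auto simp: disjoint_family_on_def)
  moreover have "card Q = card ((Q - (\<Union>j\<in>J. X j)) \<union> (\<Union>j\<in>J. X j \<inter> Q))"
    by (rule arg_cong[where f = card]) blast
  hence "card Q = card (Q - (\<Union>j\<in>J. X j)) + card (\<Union>j\<in>J. X j \<inter> Q)"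
    using assms(1,2) by (subst (asm) card_Un_disjoint) auto
  ultimately show ?thesis by simp
qed

section \<open>The random assignment: support and one-step recursion\<close>

text \<open>An invariant of all outcomes in the support. Coordinates outside \<open>{1..r}\<close>
  are left free, so writing a new set at \<open>Suc r\<close> cannot spoil what is known about the
  first \<open>r\<close> SUs.\<close>

definition valid_assignment :: "'a set \<Rightarrow> (nat \<Rightarrow> nat) \<Rightarrow> nat \<Rightarrow> (nat \<Rightarrow> 'a set) \<Rightarrow> bool" where
  "valid_assignment A s r X \<longleftrightarrow>
     disjoint_family_on X {1..r} \<and> (\<forall>j\<in>{1..r}. X j \<subseteq> A \<and> card (X j) = s j)"

definition choices :: "'a set \<Rightarrow> (nat \<Rightarrow> nat) \<Rightarrow> nat \<Rightarrow> (nat \<Rightarrow> 'a set) \<Rightarrow> 'a set set" where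
  "choices A s r X = {T. T \<subseteq> A - (\<Union>j\<in>{1..r}. X j) \<and> card T = s (Suc r)}"

lemma card_remaining:
  assumes "finite A" and "valid_assignment A s r X"
  shows "card (A - (\<Union>j\<in>{1..r}. X j)) + (\<Sum>j=1..r. s j) = card A"
proof -
  have "X j \<inter> A = X j" if "j \<in> {1..r}" for j
    using assms(2) that by (auto simp: valid_assignment_def)
  thus ?thesis
    using card_Diff_UN_disjoint[of A "{1..r}" X] assms by (simp add: valid_assignment_def)
qed

lemma finite_choices: "finite A \<Longrightarrow> finite (choices A s r X)"
  by (simp add: choices_def)

text \<open>The count is the same for every valid past, which makes the normalising constant of each
  draw deterministic.\<close>

lemma card_choices:
  assumes "finite A" and "valid_assignment A s r X"
  shows "card (choices A s r X) = (card A - (\<Sum>j=1..r. s j)) choose s (Suc r)"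
proof -
  have "card (A - (\<Union>j\<in>{1..r}. X j)) = card A - (\<Sum>j=1..r. s j)"
    using card_remaining[OF assms] by linarith
  thus ?thesis
    using assms(1) by (simp add: choices_def n_subsets)
qed

text \<open>Guards every use of \<open>pmf_of_set\<close>, which is unspecified on the empty
  set.\<close>

lemma choices_nonempty:
  assumes "finite A" and "(\<Sum>j=1..Suc r. s j) \<le> card A" and "valid_assignment A s r X"
  shows "choices A s r X \<noteq> {}"
proof -
  have "card (choices A s r X) > 0"
    using assms by (simp add: card_choices)
  thus ?thesis by auto
qed

lemma disjoint_family_on_fun_upd:
  assumes "disjoint_family_on X J" and "i \<notin> J" and "T \<inter> (\<Union>j\<in>J. X j) = {}"
  shows "disjoint_family_on (X(i := T)) (insert i J)"
  using assms by (auto simp: disjoint_family_on_def)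

lemma valid_assignment_extend:
  assumes "valid_assignment A s r X" and "T \<in> choices A s r X"
  shows "valid_assignment A s (Suc r) (X(Suc r := T))"
proof -
  have "disjoint_family_on (X(Suc r := T)) (insert (Suc r) {1..r})"
    using assms by (intro disjoint_family_on_fun_upd) (auto simp: valid_assignment_def choices_def)
  thus ?thesis
    using assms by (auto simp: valid_assignment_def choices_def atLeastAtMostSuc_conv)
qed

text \<open>The recursion in terms of \<open>choices\<close>; the raw equation then leaves the
  simpset so that \<open>assignment A s (Suc r)\<close> stays folded.\<close>

lemma assignment_Suc:
  "assignment A s (Suc r) =
     bind_pmf (assignment A s r) (\<lambda>X. map_pmf (\<lambda>T. X(Suc r := T)) (pmf_of_set (choices A s r X)))"
  by (simp add: choices_def)

declare assignment.simps(2) [simp del]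

text \<open>One induction serves both claims: validity of the past makes the next
  \<open>choices\<close> nonempty, which identifies the support of the next draw and so gives its
  finiteness and validity.\<close>

lemma
  assumes A: "finite A" and "(\<Sum>j=1..r. s j) \<le> card A"
  shows finite_set_pmf_assignment: "finite (set_pmf (assignment A s r))"
    and valid_assignmentI: "X \<in> set_pmf (assignment A s r) \<Longrightarrow> valid_assignment A s r X"
proof -
  have "finite (set_pmf (assignment A s r)) \<and>
      (\<forall>X\<in>set_pmf (assignment A s r). valid_assignment A s r X)"
    using assms(2)
  proof (induction r)
    case 0
    show ?case by (simp add: valid_assignment_def disjoint_family_on_def)
  next
    case (Suc r)
    hence IH: "finite (set_pmf (assignment A s r))"
      "\<And>X. X \<in> set_pmf (assignment A s r) \<Longrightarrow> valid_assignment A s r X"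
      by auto
    hence "\<And>X. X \<in> set_pmf (assignment A s r) \<Longrightarrow>
        set_pmf (pmf_of_set (choices A s r X)) = choices A s r X"
      using A Suc.prems by (intro set_pmf_of_set choices_nonempty finite_choices)
    thus ?case
      using IH A unfolding assignment_Suc by (auto simp: finite_choices valid_assignment_extend)
  qed
  thus "finite (set_pmf (assignment A s r))"
    and "X \<in> set_pmf (assignment A s r) \<Longrightarrow> valid_assignment A s r X" by auto
qed

lemma set_pmf_assignment_Suc:
  assumes A: "finite A" and s: "(\<Sum>j=1..Suc r. s j) \<le> card A"
  shows "set_pmf (assignment A s (Suc r)) =
    (\<Union>X\<in>set_pmf (assignment A s r). (\<lambda>T. X(Suc r := T)) ` choices A s r X)"
proof -
  have "valid_assignment A s r X" if "X \<in> set_pmf (assignment A s r)" for X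
    using valid_assignmentI[OF A _ that] s by simp
  hence "set_pmf (pmf_of_set (choices A s r X)) = choices A s r X"
    if "X \<in> set_pmf (assignment A s r)" for X
    using A s that by (intro set_pmf_of_set choices_nonempty finite_choices)
  thus ?thesis
    unfolding assignment_Suc set_bind_pmf set_map_pmf by simp
qed

text \<open>Averages over the last draw first, with the past fixed. The divisor does not mention
  \<open>X\<close> because of \<open>card_choices\<close>.\<close>

lemma expectation_assignment_Suc:
  fixes h :: "(nat \<Rightarrow> 'a set) \<Rightarrow> real"
  assumes A: "finite A" and s: "(\<Sum>j=1..Suc r. s j) \<le> card A"
  shows "measure_pmf.expectation (assignment A s (Suc r)) h =
    measure_pmf.expectation (assignment A s r) (\<lambda>X.
      (\<Sum>T\<in>choices A s r X. h (X(Suc r := T))) / real ((card A - (\<Sum>j=1..r. s j)) choose s (Suc r)))"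
proof -
  let ?p = "assignment A s r"
  let ?f = "\<lambda>X. map_pmf (\<lambda>T. X(Suc r := T)) (pmf_of_set (choices A s r X))"
  have s': "(\<Sum>j=1..r. s j) \<le> card A" using s by simp
  note [simp] = finite_set_pmf_assignment[OF A s']
  have valid: "valid_assignment A s r X" if "X \<in> set_pmf ?p" for X
    using valid_assignmentI[OF A s' that] .
  note ch = finite_choices[OF A] choices_nonempty[OF A s valid]
  have "measure_pmf.expectation (assignment A s (Suc r)) h =
      (\<Sum>X\<in>set_pmf ?p. pmf ?p X *\<^sub>R measure_pmf.expectation (?f X) h)"
    unfolding assignment_Suc
    by (rule pmf_expectation_bind) (simp_all add: set_pmf_of_set ch)
  also have "\<dots> = (\<Sum>X\<in>set_pmf ?p. pmf ?p X *\<^sub>R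
      ((\<Sum>T\<in>choices A s r X. h (X(Suc r := T))) / real ((card A - (\<Sum>j=1..r. s j)) choose s (Suc r))))"
    by (intro sum.cong refl) (simp add: integral_pmf_of_set ch card_choices[OF A valid])
  also have "\<dots> = measure_pmf.expectation ?p (\<lambda>X.
      (\<Sum>T\<in>choices A s r X. h (X(Suc r := T))) / real ((card A - (\<Sum>j=1..r. s j)) choose s (Suc r)))"
    by (rule integral_measure_pmf[symmetric]) simp_all
  finally show ?thesis .
qed

section \<open>The mean of an intersection\<close>

text \<open>The number of unassigned elements is the same for every past, so the conditional mean is
  affine in the earlier intersections and linearity suffices. If nothing is left, then
  \<open>s (Suc r) = 0\<close> and both sides are 0, as division by zero gives 0.\<close>

lemma expectation_card_Int:
  assumes A: "finite A" and s: "(\<Sum>j=1..Suc r. s j) \<le> card A" and Q: "Q \<subseteq> A"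
  shows "measure_pmf.expectation (assignment A s (Suc r)) (\<lambda>X. real (card (X (Suc r) \<inter> Q))) =
    real (s (Suc r))
    * (real (card Q) - (\<Sum>j=1..r.
         measure_pmf.expectation (assignment A s (Suc r)) (\<lambda>X. real (card (X j \<inter> Q)))))
    / (real (card A) - (\<Sum>j=1..r. real (s j)))"
proof -
  let ?p = "assignment A s r" and ?n = "card A - (\<Sum>j=1..r. s j)"
  let ?c = "real (?n choose s (Suc r))"
  have s': "(\<Sum>j=1..r. s j) \<le> card A" using s by simp
  have c: "?c \<noteq> 0" using s by simp
  have finQ: "finite Q" using A Q finite_subset by blast
  note valid = valid_assignmentI[OF A s']
  note fin = finite_set_pmf_assignment[OF A s']
  \<comment> \<open>The last draw leaves the earlier sets unchanged, so the inner average is that of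
    a constant.\<close>
  have earlier: "measure_pmf.expectation (assignment A s (Suc r)) (\<lambda>X. real (card (X j \<inter> Q)))
      = measure_pmf.expectation ?p (\<lambda>X. real (card (X j \<inter> Q)))" if "j \<in> {1..r}" for j
    unfolding expectation_assignment_Suc[OF A s]
  proof (rule integral_cong_AE, simp, simp, rule AE_pmfI)
    fix X assume "X \<in> set_pmf ?p"
    moreover have "j \<noteq> Suc r" using that by simp
    ultimately show "(\<Sum>T\<in>choices A s r X. real (card ((X(Suc r := T)) j \<inter> Q))) / ?c = real (card (X j \<inter> Q))"
      using c card_choices[OF A valid[of X]] by simp
  qed
  have "measure_pmf.expectation (assignment A s (Suc r)) (\<lambda>X. real (card (X (Suc r) \<inter> Q)))
      = measure_pmf.expectation ?p (\<lambda>X.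
          (\<Sum>T\<in>choices A s r X. real (card (T \<inter> Q))) / ?c)"
    unfolding expectation_assignment_Suc[OF A s] by simp
  also have "\<dots> = measure_pmf.expectation ?p (\<lambda>X.
      real (s (Suc r)) * (real (card Q) - (\<Sum>j=1..r. real (card (X j \<inter> Q)))) / real ?n)"
  proof (rule integral_cong_AE)
    have "(\<Sum>T\<in>choices A s r X. real (card (T \<inter> Q))) / ?c =
      real (s (Suc r)) * (real (card Q) - (\<Sum>j=1..r. real (card (X j \<inter> Q)))) / real ?n"
      if X: "X \<in> set_pmf ?p" for X
    proof -
      let ?R = "A - (\<Union>j\<in>{1..r}. X j)"
      have R: "card ?R = ?n"
        using card_remaining[OF A valid[OF X]] by linarith
      \<comment> \<open>A draw avoids assigned elements, so \<open>Q\<close> may be replaced by its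
        unassigned part, which lies inside the set drawn from as the hypergeometric mean
        requires.\<close>
      have "T \<inter> Q = T \<inter> (Q - (\<Union>j\<in>{1..r}. X j))" if "T \<in> choices A s r X" for T
        using that by (auto simp: choices_def)
      hence "(\<Sum>T\<in>choices A s r X. real (card (T \<inter> Q)))
          = (\<Sum>T\<in>choices A s r X. real (card (T \<inter> (Q - (\<Union>j\<in>{1..r}. X j)))))"
        by (intro sum.cong refl) (simp only:)
      moreover have "(\<Sum>T\<in>choices A s r X. real (card (T \<inter> (Q - (\<Union>j\<in>{1..r}. X j))))) / ?c
          = real (s (Suc r)) * real (card (Q - (\<Union>j\<in>{1..r}. X j))) / real ?n"
        unfolding choices_def R[symmetric]
      proof (rule sum_card_Int_subsets)
        show "finite ?R" using A by simp
        show "Q - (\<Union>j\<in>{1..r}. X j) \<subseteq> ?R" using Q by blast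
        show "s (Suc r) \<le> card ?R" unfolding R using s by simp
      qed
      moreover have "card (Q - (\<Union>j\<in>{1..r}. X j)) + (\<Sum>j=1..r. card (X j \<inter> Q)) = card Q"
        using valid[OF X] by (intro card_Diff_UN_disjoint finQ) (auto simp: valid_assignment_def)
      hence "real (card (Q - (\<Union>j\<in>{1..r}. X j))) = real (card Q) - (\<Sum>j=1..r. real (card (X j \<inter> Q)))"
        by (simp flip: of_nat_sum of_nat_add)
      ultimately show ?thesis by (simp only:)
    qed
    thus "AE X in measure_pmf ?p. (\<Sum>T\<in>choices A s r X. real (card (T \<inter> Q))) / ?c =
      real (s (Suc r)) * (real (card Q) - (\<Sum>j=1..r. real (card (X j \<inter> Q)))) / real ?n"
      by (rule AE_pmfI)
  qed simp_all
  also have "\<dots> = real (s (Suc r)) * (real (card Q) - (\<Sum>j=1..r.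
      measure_pmf.expectation ?p (\<lambda>X. real (card (X j \<inter> Q))))) / real ?n"
    by (simp add: integrable_measure_pmf_finite[OF fin])
  also have "real ?n = real (card A) - (\<Sum>j=1..r. real (s j))"
    using s' by (simp add: of_nat_diff)
  also have "(\<Sum>j=1..r. measure_pmf.expectation ?p (\<lambda>X. real (card (X j \<inter> Q))))
      = (\<Sum>j=1..r. measure_pmf.expectation (assignment A s (Suc r)) (\<lambda>X. real (card (X j \<inter> Q))))"
    by (intro sum.cong refl earlier[symmetric])
  finally show ?thesis .
qed

section \<open>Colour profiles of the sets drawn from a partitioned set\<close>

locale coloured_set =
  fixes A :: "'a set" and I :: "'i set" and B :: "'i \<Rightarrow> 'a set"
  assumes fin: "finite A" and finI: "finite I"
    and disj: "disjoint_family_on B I" and cover: "(\<Union>i\<in>I. B i) = A"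
begin

lemma finite_colour: "i \<in> I \<Longrightarrow> finite (B i)"
  by (rule finite_subset[OF _ fin]) (use cover in blast)

lemma sum_card_Int_colours:
  assumes "T \<subseteq> A"
  shows "(\<Sum>i\<in>I. card (T \<inter> B i)) = card T"
proof -
  have "T = (\<Union>i\<in>I. T \<inter> B i)" using assms cover by auto
  hence "card T = card (\<Union>i\<in>I. T \<inter> B i)" by simp
  also have "\<dots> = (\<Sum>i\<in>I. card (T \<inter> B i))"
    using disj finI finite_colour by (intro card_UN_disjoint') (auto simp: disjoint_family_on_def)
  finally show ?thesis by simp
qed

text \<open>An event on outcomes that reads \<open>K\<close> only at SUs \<open>1..r\<close> and
  colours in \<open>I\<close>, so no extensionality of vectors enters here.\<close>

definition has_profiles :: "nat \<Rightarrow> (nat \<Rightarrow> 'i \<Rightarrow> nat) \<Rightarrow> (nat \<Rightarrow> 'a set) set" where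
  "has_profiles r K = {X. \<forall>j\<in>{1..r}. \<forall>i\<in>I. card (X j \<inter> B i) = K j i}"

text \<open>The condition on \<open>T\<close> is phrased as set membership so that the indicator of
  the event factors into a past part and a last-draw part.\<close>

lemma has_profiles_Suc_iff:
  "X(Suc r := T) \<in> has_profiles (Suc r) K \<longleftrightarrow>
     X \<in> has_profiles r K \<and> T \<in> {T. \<forall>i\<in>I. card (T \<inter> B i) = K (Suc r) i}"
  by (auto simp: has_profiles_def atLeastAtMostSuc_conv)

lemma card_remaining_colour:
  assumes "valid_assignment A s r X" and "X \<in> has_profiles r K" and "i \<in> I"
  shows "card (B i - (\<Union>j\<in>{1..r}. X j)) + (\<Sum>j=1..r. K j i) = card (B i)"
  using card_Diff_UN_disjoint[OF finite_colour[OF assms(3)], of "{1..r}" X] assms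
  by (simp add: valid_assignment_def has_profiles_def)

text \<open>Since the prescribed counts add up to \<open>s (Suc r)\<close>, the profile already
  forces the size of \<open>T\<close>; what remains is an independent choice in the unassigned part
  of each colour.\<close>

lemma card_choices_with_profile:
  assumes X: "valid_assignment A s r X" "X \<in> has_profiles r K" and k: "(\<Sum>i\<in>I. k i) = s (Suc r)"
  shows "card {T \<in> choices A s r X. \<forall>i\<in>I. card (T \<inter> B i) = k i}
    = (\<Prod>i\<in>I. (card (B i) - (\<Sum>j=1..r. K j i)) choose k i)"
proof -
  let ?U = "\<Union>j\<in>{1..r}. X j"
  have "{T \<in> choices A s r X. \<forall>i\<in>I. card (T \<inter> B i) = k i}
      = {T. T \<subseteq> (\<Union>i\<in>I. B i - ?U) \<and> (\<forall>i\<in>I. card (T \<inter> (B i - ?U)) = k i)}"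
  proof -
    have "T \<subseteq> A - ?U \<and> card T = s (Suc r) \<and> (\<forall>i\<in>I. card (T \<inter> B i) = k i)
      \<longleftrightarrow> T \<subseteq> A - ?U \<and> (\<forall>i\<in>I. card (T \<inter> (B i - ?U)) = k i)" for T
    proof (cases "T \<subseteq> A - ?U")
      case True
      hence "T \<inter> (B i - ?U) = T \<inter> B i" for i by blast
      moreover have "T \<subseteq> A" using True by blast
      ultimately show ?thesis
        using sum_card_Int_colours[of T] k by auto
    qed simp
    moreover have "(\<Union>i\<in>I. B i - ?U) = A - ?U" using cover by blast
    ultimately show ?thesis by (simp add: choices_def)
  qed
  also have "card \<dots> = (\<Prod>i\<in>I. card (B i - ?U) choose k i)"
    using disj finite_colour by (intro card_subsets_with_profile finI) (auto simp: disjoint_family_on_def)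
  also have "\<dots> = (\<Prod>i\<in>I. (card (B i) - (\<Sum>j=1..r. K j i)) choose k i)"
  proof (intro prod.cong refl)
    fix i assume "i \<in> I"
    have "card (B i - ?U) = card (B i) - (\<Sum>j=1..r. K j i)"
      using card_remaining_colour[OF X \<open>i \<in> I\<close>] by linarith
    thus "card (B i - ?U) choose k i = (card (B i) - (\<Sum>j=1..r. K j i)) choose k i" by simp
  qed
  finally show ?thesis .
qed

text \<open>Factor \<open>q\<close> is the proportion of favourable draws of SU \<open>q\<close>;
  for \<open>q = 1\<close> the sums over \<open>{1..q-1}\<close> are empty. If a colour is
  overdrawn, the binomial at the step where this first happens is 0, so truncated differences in
  later factors do no harm.\<close>

lemma prob_has_profiles:
  assumes "(\<Sum>j=1..r. s j) \<le> card A" and "\<And>j. j \<in> {1..r} \<Longrightarrow> (\<Sum>i\<in>I. K j i) = s j"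
  shows "measure_pmf.prob (assignment A s r) (has_profiles r K) =
    (\<Prod>q=1..r. (\<Prod>i\<in>I. real ((card (B i) - (\<Sum>j=1..q-1. K j i)) choose K q i))
      / real ((card A - (\<Sum>j=1..q-1. s j)) choose s q))"
  using assms
proof (induction r)
  case 0
  show ?case by (simp add: has_profiles_def)
next
  case (Suc r)
  let ?p = "assignment A s r"
  let ?c = "real ((card A - (\<Sum>j=1..r. s j)) choose s (Suc r))"
  let ?d = "\<Prod>i\<in>I. real ((card (B i) - (\<Sum>j=1..r. K j i)) choose K (Suc r) i)"
  have s': "(\<Sum>j=1..r. s j) \<le> card A" using Suc.prems(1) by simp
  have "measure_pmf.prob (assignment A s (Suc r)) (has_profiles (Suc r) K)
      = measure_pmf.expectation (assignment A s (Suc r)) (indicator (has_profiles (Suc r) K))"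
    by simp
  also have "\<dots> = measure_pmf.expectation ?p (\<lambda>X.
      (\<Sum>T\<in>choices A s r X. indicator (has_profiles (Suc r) K) (X(Suc r := T))) / ?c)"
    by (rule expectation_assignment_Suc[OF fin Suc.prems(1)])
  also have "\<dots> = measure_pmf.expectation ?p (\<lambda>X. indicator (has_profiles r K) X * (?d / ?c))"
  proof (rule integral_cong_AE)
    have "(\<Sum>T\<in>choices A s r X. indicator (has_profiles (Suc r) K) (X(Suc r := T))) / ?c
        = indicator (has_profiles r K) X * (?d / ?c)" if X: "X \<in> set_pmf ?p" for X
    proof -
      have ind: "indicator (has_profiles (Suc r) K) (X(Suc r := T))
          = indicator (has_profiles r K) X * (indicator {T. \<forall>i\<in>I. card (T \<inter> B i) = K (Suc r) i} T :: real)"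
        for T
        unfolding has_profiles_Suc_iff indicator_def by simp
      \<comment> \<open>Outside \<open>has_profiles r K\<close> both sides vanish, so the favourable
        draws need counting only for pasts inside it.\<close>
      have "(\<Sum>T\<in>choices A s r X. indicator {T. \<forall>i\<in>I. card (T \<inter> B i) = K (Suc r) i} T) = ?d"
        if "X \<in> has_profiles r K"
      proof -
        have "(\<Sum>T\<in>choices A s r X. indicator {T. \<forall>i\<in>I. card (T \<inter> B i) = K (Suc r) i} T)
            = real (card {T \<in> choices A s r X. \<forall>i\<in>I. card (T \<inter> B i) = K (Suc r) i})"
          using finite_choices[OF fin] by (simp add: indicator_def sum.If_cases Int_def)
        also have "card {T \<in> choices A s r X. \<forall>i\<in>I. card (T \<inter> B i) = K (Suc r) i}
            = (\<Prod>i\<in>I. (card (B i) - (\<Sum>j=1..r. K j i)) choose K (Suc r) i)"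
          by (rule card_choices_with_profile[OF valid_assignmentI[OF fin s' X] that])
             (rule Suc.prems(2), simp)
        finally show ?thesis by simp
      qed
      thus ?thesis
        unfolding ind sum_distrib_left[symmetric] by (auto simp: indicator_def)
    qed
    thus "AE X in measure_pmf ?p. (\<Sum>T\<in>choices A s r X. indicator (has_profiles (Suc r) K) (X(Suc r := T))) / ?c
        = indicator (has_profiles r K) X * (?d / ?c)"
      by (rule AE_pmfI)
  qed simp_all
  also have "\<dots> = measure_pmf.prob ?p (has_profiles r K) * (?d / ?c)"
    by simp
  also have "measure_pmf.prob ?p (has_profiles r K) =
    (\<Prod>q=1..r. (\<Prod>i\<in>I. real ((card (B i) - (\<Sum>j=1..q-1. K j i)) choose K q i))
      / real ((card A - (\<Sum>j=1..q-1. s j)) choose s q))"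
    by (rule Suc.IH[OF s']) (rule Suc.prems(2), simp)
  finally show ?case
    by (subst prod.nat_ivl_Suc') (simp_all only: diff_Suc_1 mult.commute)
qed

text \<open>Disjointness of the drawn sets forbids overdrawing a colour. Conversely, if none is
  overdrawn, all binomials counting the suitable last draws are positive.\<close>

lemma extends_with_profile_iff:
  assumes s: "(\<Sum>j=1..Suc r. s j) \<le> card A"
    and feasible: "set_pmf (assignment A s (Suc r)) \<inter> has_profiles r h \<noteq> {}"
  shows "(\<exists>X\<in>set_pmf (assignment A s (Suc r)) \<inter> has_profiles r h. \<forall>i\<in>I. card (X (Suc r) \<inter> B i) = k i)
    \<longleftrightarrow> (\<Sum>i\<in>I. k i) = s (Suc r) \<and> (\<forall>i\<in>I. k i + (\<Sum>j=1..r. h j i) \<le> card (B i))"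
    (is "?L \<longleftrightarrow> ?R")
proof
  assume ?L
  then obtain X where X: "X \<in> set_pmf (assignment A s (Suc r))" "X \<in> has_profiles r h"
    "\<And>i. i \<in> I \<Longrightarrow> card (X (Suc r) \<inter> B i) = k i" by blast
  have v: "valid_assignment A s (Suc r) X"
    using valid_assignmentI[OF fin s X(1)] .
  have "X \<in> has_profiles (Suc r) (h(Suc r := k))"
    using X(2,3) by (auto simp: has_profiles_def atLeastAtMostSuc_conv)
  from card_remaining_colour[OF v this]
  have "k i + (\<Sum>j=1..r. h j i) \<le> card (B i)" if "i \<in> I" for i
    using that by fastforce
  moreover have "(\<Sum>i\<in>I. k i) = s (Suc r)"
    using X(3) v sum_card_Int_colours[of "X (Suc r)"] by (simp add: valid_assignment_def)
  ultimately show ?R by blast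
next
  assume R: ?R
  note set_Suc = set_pmf_assignment_Suc[OF fin s]
  \<comment> \<open>Only the past \<open>Y\<close> of the feasible outcome is kept; its last draw is
    replaced below by one with profile \<open>k\<close>.\<close>
  from feasible obtain Y T where Y: "Y \<in> set_pmf (assignment A s r)" "Y(Suc r := T) \<in> has_profiles r h"
    unfolding set_Suc by blast
  have Yh: "Y \<in> has_profiles r h" using Y(2) by (simp add: has_profiles_def)
  have "valid_assignment A s r Y"
    using s by (intro valid_assignmentI[OF fin _ Y(1)]) simp
  hence "card {T \<in> choices A s r Y. \<forall>i\<in>I. card (T \<inter> B i) = k i} > 0"
    using R finI by (subst card_choices_with_profile[OF _ Yh]) (auto intro!: prod_pos simp: le_diff_conv2)
  then obtain T where T: "T \<in> choices A s r Y" "\<forall>i\<in>I. card (T \<inter> B i) = k i"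
    by (auto simp: card_gt_0_iff)
  have "Y(Suc r := T) \<in> set_pmf (assignment A s (Suc r)) \<inter> has_profiles r h"
    using T(1) Y(1) Yh unfolding set_Suc by (auto simp: has_profiles_def)
  moreover have "\<forall>i\<in>I. card ((Y(Suc r := T)) (Suc r) \<inter> B i) = k i" using T(2) by simp
  ultimately show ?L by blast
qed

end

section \<open>Marginals of a joint law of finite support\<close>

text \<open>The product of the marginal supports may exceed the support of the other coordinates
  jointly, but the additional terms are 0.\<close>

lemma pmf_marginal:
  fixes J :: "('i \<Rightarrow> 'b) pmf"
  assumes J: "finite (set_pmf J)" "set_pmf J \<subseteq> extensional S" and S: "finite S" "m \<in> S"
  shows "pmf (map_pmf (\<lambda>K. K m) J) k =
    (\<Sum>K\<in>(\<Pi>\<^sub>E j\<in>S - {m}. set_pmf (map_pmf (\<lambda>K. K j) J)). pmf J (K(m := k)))"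
proof -
  let ?D = "\<Pi>\<^sub>E j\<in>S - {m}. set_pmf (map_pmf (\<lambda>K. K j) J)"
  have fin: "finite ?D" using J(1) S(1) by (intro finite_PiE) auto
  \<comment> \<open>Members of \<open>?D\<close> are all \<open>undefined\<close> at
    \<open>m\<close>, so overwriting that value loses nothing.\<close>
  have inj: "inj_on (\<lambda>K. K(m := k)) ?D"
  proof (rule inj_onI)
    fix K L assume "K \<in> ?D" "L \<in> ?D" "K(m := k) = L(m := k)"
    moreover from this have "K m = L m" by (metis Diff_iff PiE_arb insertI1)
    ultimately show "K = L" by (metis fun_upd_triv fun_upd_upd)
  qed
  have sub: "(\<lambda>K. K m) -` {k} \<inter> set_pmf J \<subseteq> (\<lambda>K. K(m := k)) ` ?D"
  proof
    fix L assume L: "L \<in> (\<lambda>K. K m) -` {k} \<inter> set_pmf J"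
    hence "L = (restrict L (S - {m}))(m := k)"
      using J(2) by (auto simp: fun_eq_iff extensional_def restrict_def)
    moreover have "restrict L (S - {m}) \<in> ?D" using L by auto
    ultimately show "L \<in> (\<lambda>K. K(m := k)) ` ?D" by blast
  qed
  have "pmf (map_pmf (\<lambda>K. K m) J) k = measure_pmf.prob J ((\<lambda>K. K m) -` {k})"
    by (simp add: pmf_map)
  also have "\<dots> = measure_pmf.prob J ((\<lambda>K. K(m := k)) ` ?D)"
  proof (rule antisym)
    show "measure_pmf.prob J ((\<lambda>K. K m) -` {k}) \<le> measure_pmf.prob J ((\<lambda>K. K(m := k)) ` ?D)"
      unfolding measure_Int_set_pmf[of J "(\<lambda>K. K m) -` {k}", symmetric]
      using sub by (intro measure_pmf.finite_measure_mono) auto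
    show "measure_pmf.prob J ((\<lambda>K. K(m := k)) ` ?D) \<le> measure_pmf.prob J ((\<lambda>K. K m) -` {k})"
      by (intro measure_pmf.finite_measure_mono) auto
  qed
  also have "\<dots> = (\<Sum>K\<in>?D. pmf J (K(m := k)))"
    unfolding measure_measure_pmf_finite[OF finite_imageI[OF fin]] sum.reindex[OF inj] comp_def ..
  finally show ?thesis .
qed

section \<open>Translation to PUs and free subcarriers\<close>

text \<open>The support is conditional on the earlier vectors \<open>h\<close>. Its bound on the
  free coordinate is a separate condition: for \<open>m = 1\<close>, \<open>N = 2\<close>,
  \<open>FP 1 = FP 2 = 1\<close>, \<open>F = 3\<close> and \<open>FS 1 = 2\<close>, the vector
  \<open>(0, 0, 2)\<close> satisfies the sum and interval conditions although only one subcarrier is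
  free.\<close>

theorem proposition2:
  fixes A :: "'a set" and P :: "nat \<Rightarrow> 'a set"
    and F Ff N m :: nat and FP FS :: "nat \<Rightarrow> nat"
  assumes "finite A" and "card A = F"
    and "\<And>n. n \<in> {1..N} \<Longrightarrow> P n \<subseteq> A"
    and "\<And>n. n \<in> {1..N} \<Longrightarrow> card (P n) = FP n"
    and "disjoint_family_on P {1..N}"
    and "Ff = F - (\<Sum>n=1..N. FP n)"
    and "m \<ge> 1"
    and "(\<Sum>j=1..m. FS j) \<le> F"
  shows
    "(\<forall>k \<in> vecs N.
        pmf (collision_pmf A P N FS m m) k =
          (\<Sum>K \<in> (\<Pi>\<^sub>E j\<in>{1..<m}. set_pmf (collision_pmf A P N FS m j)).
             pmf (joint_collision_pmf A P N FS m) (K(m := k))))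
   \<and> (\<forall>K \<in> (\<Pi>\<^sub>E j\<in>{1..m}. {k \<in> vecs N. (\<Sum>i=1..N+1. k i) = FS j}).
        pmf (joint_collision_pmf A P N FS m) K =
          (real (Ff choose K 1 (N+1)) * inverse (real (F choose FS 1))
             * (\<Prod>n=1..N. real (FP n choose K 1 n)))
          * (\<Prod>r=2..m.
               real ((Ff - (\<Sum>j=1..r-1. K j (N+1))) choose K r (N+1))
               * inverse (real ((F - (\<Sum>i=1..N+1. \<Sum>j=1..r-1. K j i)) choose FS r))
               * (\<Prod>n=1..N. real ((FP n - (\<Sum>j=1..r-1. K j n)) choose K r n))))
   \<and> (\<forall>n \<in> {1..N}.
        measure_pmf.expectation (assignment A FS m) (\<lambda>X. real (collisions P N (X m) n)) =
          real (FS m)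
          * (real (FP n) - (\<Sum>j=1..m-1.
               measure_pmf.expectation (assignment A FS m) (\<lambda>X. real (collisions P N (X j) n))))
          / (real F - (\<Sum>j=1..m-1. real (FS j))))
   \<and> (\<forall>h. (\<exists>X \<in> set_pmf (assignment A FS m). \<forall>j\<in>{1..<m}. collisions P N (X j) = h j) \<longrightarrow>
        set_pmf (cond_collision_pmf A P N FS m h) =
          {k \<in> vecs N.
             (\<Sum>n=1..N. k n) + k (N+1) = FS m \<and>
             (\<forall>n\<in>{1..N}. int (k n) \<in>
                {max 0 (int (FS m) + int (FP n) - (\<Sum>j=1..m-1. int (h j n)) - int F) ..
                 min (int (FS m)) (int (FP n) - (\<Sum>j=1..m-1. int (h j n)))})}
          \<inter> {k. k (N+1) + (\<Sum>j=1..m-1. h j (N+1)) \<le> Ff})"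
proof -
  obtain r where m: "m = Suc r" using assms(7) by (cases m) auto
  define I where "I = {1..N+1}"
  define B where "B i = (if i \<le> N then P i else A - (\<Union>n\<in>{1..N}. P n))" for i
  define p where "p = assignment A FS m"
  have I: "I = insert (N+1) {1..N}" by (auto simp: I_def)
  interpret coloured_set A I B
  proof
    show "disjoint_family_on B I"
      using assms(5) unfolding I by (auto simp: disjoint_family_on_def B_def)
    show "(\<Union>i\<in>I. B i) = A"
    proof -
      have "(\<Union>n\<in>{1..N}. B n) = (\<Union>n\<in>{1..N}. P n)" by (simp add: B_def)
      hence "(\<Union>i\<in>I. B i) = (A - (\<Union>n\<in>{1..N}. P n)) \<union> (\<Union>n\<in>{1..N}. P n)"
        unfolding I UN_insert by (simp only:) (simp add: B_def)
      also have "\<dots> = A" using assms(3) by blast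
      finally show ?thesis .
    qed
  qed (simp_all add: assms(1) I_def)
  have sF: "(\<Sum>j=1..m. FS j) \<le> card A" using assms(2,8) by simp
  have card_PU: "card (B n) = FP n" if "n \<in> {1..N}" for n
    using that assms(4) by (simp add: B_def)
  have sum_card_B: "(\<Sum>i\<in>I. card (B i)) = F"
  proof -
    have "A \<inter> B i = B i" if "i \<in> I" for i using cover that by blast
    thus ?thesis using sum_card_Int_colours[of A] assms(2) by simp
  qed
  \<comment> \<open>The classes partition \<open>A\<close>, so the natural subtraction defining
    \<open>Ff\<close> is exact.\<close>
  hence card_free: "card (B (N+1)) = Ff"
    unfolding I using assms(6) card_PU by simp
  have collisions_eq: "collisions P N T = (\<lambda>i\<in>I. card (T \<inter> B i))" if "T \<subseteq> A" for T
  proof -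
    have "T - (\<Union>n\<in>{1..N}. P n) = T \<inter> (A - (\<Union>n\<in>{1..N}. P n))" using that by blast
    thus ?thesis by (auto simp: collisions_def I_def B_def fun_eq_iff)
  qed
  have collisions_iff: "collisions P N T = k \<longleftrightarrow> (\<forall>i\<in>I. card (T \<inter> B i) = k i)"
    if "T \<subseteq> A" "k \<in> vecs N" for T k
  proof -
    have "k \<in> extensional I" using that(2) by (simp add: vecs_def I_def PiE_def)
    thus ?thesis unfolding collisions_eq[OF that(1)] by (auto simp: fun_eq_iff extensional_def)
  qed
  have in_vecs: "collisions P N T \<in> vecs N" for T
    by (auto simp: collisions_def vecs_def)
  have subset: "X j \<subseteq> A" if "X \<in> set_pmf p" "j \<in> {1..m}" for X j
    using valid_assignmentI[OF fin sF] that by (simp add: valid_assignment_def p_def)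

  have "pmf (collision_pmf A P N FS m m) k =
      (\<Sum>K \<in> (\<Pi>\<^sub>E j\<in>{1..<m}. set_pmf (collision_pmf A P N FS m j)).
         pmf (joint_collision_pmf A P N FS m) (K(m := k)))" for k
  proof -
    have marg: "map_pmf (\<lambda>K. K j) (joint_collision_pmf A P N FS m) = collision_pmf A P N FS m j"
      if "j \<in> {1..m}" for j
      using that by (simp add: joint_collision_pmf_def collision_pmf_def pmf.map_comp comp_def)
    have "pmf (map_pmf (\<lambda>K. K m) (joint_collision_pmf A P N FS m)) k =
        (\<Sum>K \<in> (\<Pi>\<^sub>E j\<in>{1..m} - {m}. set_pmf (map_pmf (\<lambda>K. K j) (joint_collision_pmf A P N FS m))).
           pmf (joint_collision_pmf A P N FS m) (K(m := k)))"
      using finite_set_pmf_assignment[OF fin sF] m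
      by (intro pmf_marginal) (auto simp: joint_collision_pmf_def)
    also have "{1..m} - {m} = {1..<m}" by auto
    also have "(\<Pi>\<^sub>E j\<in>{1..<m}. set_pmf (map_pmf (\<lambda>K. K j) (joint_collision_pmf A P N FS m)))
        = (\<Pi>\<^sub>E j\<in>{1..<m}. set_pmf (collision_pmf A P N FS m j))"
      by (intro PiE_cong arg_cong[where f = set_pmf] marg) auto
    also have "map_pmf (\<lambda>K. K m) (joint_collision_pmf A P N FS m) = collision_pmf A P N FS m m"
      by (rule marg) (simp add: m)
    finally show ?thesis .
  qed
  moreover have "pmf (joint_collision_pmf A P N FS m) K =
          (real (Ff choose K 1 (N+1)) * inverse (real (F choose FS 1))
             * (\<Prod>n=1..N. real (FP n choose K 1 n)))
          * (\<Prod>r=2..m.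
               real ((Ff - (\<Sum>j=1..r-1. K j (N+1))) choose K r (N+1))
               * inverse (real ((F - (\<Sum>i=1..N+1. \<Sum>j=1..r-1. K j i)) choose FS r))
               * (\<Prod>n=1..N. real ((FP n - (\<Sum>j=1..r-1. K j n)) choose K r n)))"
    if K: "K \<in> (\<Pi>\<^sub>E j\<in>{1..m}. {k \<in> vecs N. (\<Sum>i=1..N+1. k i) = FS j})" for K
  proof -
    let ?t = "\<lambda>q. real ((Ff - (\<Sum>j=1..q-1. K j (N+1))) choose K q (N+1))
               * inverse (real ((F - (\<Sum>i=1..N+1. \<Sum>j=1..q-1. K j i)) choose FS q))
               * (\<Prod>n=1..N. real ((FP n - (\<Sum>j=1..q-1. K j n)) choose K q n))"
    have Kj: "K j \<in> vecs N" "(\<Sum>i=1..N+1. K j i) = FS j" if "j \<in> {1..m}" for j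
      using PiE_mem[OF K that] by auto
    have "pmf (joint_collision_pmf A P N FS m) K
        = measure_pmf.prob p ((\<lambda>X. \<lambda>j\<in>{1..m}. collisions P N (X j)) -` {K})"
      by (simp add: joint_collision_pmf_def pmf_map p_def)
    \<comment> \<open>The two events need to agree only on the support, where each
      \<open>X j\<close> lies in \<open>A\<close>; there, \<open>T\<close> minus all PU sets is
      \<open>T\<close> intersected with the free class.\<close>
    also have "\<dots> = measure_pmf.prob p (has_profiles m K)"
    proof (rule measure_pmf.finite_measure_eq_AE)
      show "AE X in measure_pmf p.
          (X \<in> (\<lambda>X. \<lambda>j\<in>{1..m}. collisions P N (X j)) -` {K}) = (X \<in> has_profiles m K)"
      proof (rule AE_pmfI)
        fix X assume X: "X \<in> set_pmf p"
        have "X \<in> (\<lambda>X. \<lambda>j\<in>{1..m}. collisions P N (X j)) -` {K}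
            \<longleftrightarrow> (\<forall>j\<in>{1..m}. collisions P N (X j) = K j)"
          using PiE_arb[OF K] by (auto simp: fun_eq_iff[of "restrict _ _"])
        also have "\<dots> \<longleftrightarrow> X \<in> has_profiles m K"
          using collisions_iff[OF subset[OF X] Kj(1)] by (simp add: has_profiles_def)
        finally show "(X \<in> (\<lambda>X. \<lambda>j\<in>{1..m}. collisions P N (X j)) -` {K}) = (X \<in> has_profiles m K)" .
      qed
    qed simp_all
    also have "\<dots> = (\<Prod>q=1..m. (\<Prod>i\<in>I. real ((card (B i) - (\<Sum>j=1..q-1. K j i)) choose K q i))
        / real ((card A - (\<Sum>j=1..q-1. FS j)) choose FS q))"
      unfolding p_def by (rule prob_has_profiles[OF sF]) (simp only: I_def Kj(2))
    also have "\<dots> = (\<Prod>q=1..m. ?t q)"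
    proof (rule prod.cong[OF refl])
      fix q assume q: "q \<in> {1..m}"
      \<comment> \<open>Each vector sums to the demand of its SU, so the total over colours is the
        number of subcarriers already assigned.\<close>
      have "(\<Sum>i=1..N+1. \<Sum>j=1..q-1. K j i) = (\<Sum>j=1..q-1. \<Sum>i=1..N+1. K j i)"
        by (rule sum.swap)
      also have "\<dots> = (\<Sum>j=1..q-1. FS j)"
        by (rule sum.cong[OF refl], rule Kj(2)) (use q in auto)
      finally have "(\<Sum>i=1..N+1. \<Sum>j=1..q-1. K j i) = (\<Sum>j=1..q-1. FS j)" .
      moreover have "(\<Prod>i\<in>I. real ((card (B i) - (\<Sum>j=1..q-1. K j i)) choose K q i))
          = real ((Ff - (\<Sum>j=1..q-1. K j (N+1))) choose K q (N+1))
            * (\<Prod>n=1..N. real ((FP n - (\<Sum>j=1..q-1. K j n)) choose K q n))"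
        unfolding I card_free[symmetric] by (simp add: card_PU)
      ultimately show "(\<Prod>i\<in>I. real ((card (B i) - (\<Sum>j=1..q-1. K j i)) choose K q i))
          / real ((card A - (\<Sum>j=1..q-1. FS j)) choose FS q) = ?t q"
        by (simp only: assms(2) divide_inverse mult_ac)
    qed
    \<comment> \<open>The first SU is the factor \<open>q = 1\<close>, whose sums over earlier SUs
      are empty.\<close>
    also have "\<dots> = ?t 1 * (\<Prod>q=2..m. ?t q)"
      using assms(7) by (subst prod.atLeast_Suc_atMost) (simp_all add: numeral_2_eq_2)
    finally show ?thesis by simp
  qed
  moreover have "measure_pmf.expectation (assignment A FS m) (\<lambda>X. real (collisions P N (X m) n)) =
          real (FS m)
          * (real (FP n) - (\<Sum>j=1..m-1.
               measure_pmf.expectation (assignment A FS m) (\<lambda>X. real (collisions P N (X j) n))))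
          / (real F - (\<Sum>j=1..m-1. real (FS j)))"
    if n: "n \<in> {1..N}" for n
  proof -
    have "collisions P N T n = card (T \<inter> P n)" for T
      using n by (simp add: collisions_def)
    thus ?thesis
      using expectation_card_Int[OF fin sF[unfolded m] assms(3)[OF n]] assms(2) assms(4)[OF n]
      by (simp add: m)
  qed
  moreover have "set_pmf (cond_collision_pmf A P N FS m h) =
          {k \<in> vecs N.
             (\<Sum>n=1..N. k n) + k (N+1) = FS m \<and>
             (\<forall>n\<in>{1..N}. int (k n) \<in>
                {max 0 (int (FS m) + int (FP n) - (\<Sum>j=1..m-1. int (h j n)) - int F) ..
                 min (int (FS m)) (int (FP n) - (\<Sum>j=1..m-1. int (h j n)))})}
          \<inter> {k. k (N+1) + (\<Sum>j=1..m-1. h j (N+1)) \<le> Ff}"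
    if h: "\<exists>X \<in> set_pmf (assignment A FS m). \<forall>j\<in>{1..<m}. collisions P N (X j) = h j" for h
  proof -
    let ?E = "{X. \<forall>j\<in>{1..<m}. collisions P N (X j) = h j}"
    \<comment> \<open>The conditioning event is attained, so each \<open>h j\<close> is an actual
      collision vector and hence extensional.\<close>
    have h_vecs: "h j \<in> vecs N" if "j \<in> {1..<m}" for j
      using h that in_vecs by metis
    have E: "set_pmf p \<inter> ?E = set_pmf p \<inter> has_profiles r h"
    proof -
      have "X \<in> ?E \<longleftrightarrow> X \<in> has_profiles r h" if X: "X \<in> set_pmf p" for X
      proof -
        have "{1..<m} = {1..r}" using m by auto
        thus ?thesis
          using collisions_iff[OF subset[OF X] h_vecs] m by (simp add: has_profiles_def)
      qed
      thus ?thesis by blast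
    qed
    have ne: "set_pmf p \<inter> ?E \<noteq> {}" using h by (auto simp: p_def)
    have "set_pmf (cond_collision_pmf A P N FS m h) =
        (\<lambda>X. collisions P N (X m)) ` (set_pmf p \<inter> has_profiles r h)"
      using set_cond_pmf[OF ne] unfolding E by (simp add: cond_collision_pmf_def p_def)
    also have "\<dots> = {k \<in> vecs N. \<exists>X\<in>set_pmf p \<inter> has_profiles r h. \<forall>i\<in>I. card (X m \<inter> B i) = k i}"
      using collisions_iff[OF subset] in_vecs m by fastforce
    also have "\<dots> = {k \<in> vecs N. (\<Sum>i\<in>I. k i) = FS m \<and> (\<forall>i\<in>I. k i + (\<Sum>j=1..r. h j i) \<le> card (B i))}"
      using extends_with_profile_iff[OF sF[unfolded m], of h] ne unfolding E
      by (simp add: p_def m)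
    also have "\<dots> = {k \<in> vecs N.
             (\<Sum>n=1..N. k n) + k (N+1) = FS m \<and>
             (\<forall>n\<in>{1..N}. int (k n) \<in>
                {max 0 (int (FS m) + int (FP n) - (\<Sum>j=1..m-1. int (h j n)) - int F) ..
                 min (int (FS m)) (int (FP n) - (\<Sum>j=1..m-1. int (h j n)))})}
          \<inter> {k. k (N+1) + (\<Sum>j=1..m-1. h j (N+1)) \<le> Ff}" (is "?L = ?R")
    proof (rule set_eqI, rule iffI)
      fix k assume k: "k \<in> ?L"
      hence le: "k i + (\<Sum>j=1..r. h j i) \<le> card (B i)" if "i \<in> I" for i using that by blast
      \<comment> \<open>The lower bound holds because the other colours cannot absorb more than \<open>F - FP n\<close>.\<close>
      have bounds: "int (k n) \<in>
          {max 0 (int (FS m) + int (FP n) - (\<Sum>j=1..m-1. int (h j n)) - int F) ..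
           min (int (FS m)) (int (FP n) - (\<Sum>j=1..m-1. int (h j n)))}" if n: "n \<in> {1..N}" for n
      proof -
        have nI: "n \<in> I" using n by (simp add: I_def)
        \<comment> \<open>Bounds what all colours other than \<open>n\<close> can supply; with both
          totals known, this leaves a minimum for \<open>k n\<close>.\<close>
        have "(\<Sum>i\<in>I - {n}. k i) \<le> (\<Sum>i\<in>I - {n}. card (B i))"
          by (rule sum_mono) (use le in fastforce)
        moreover have "(\<Sum>i\<in>I. k i) = k n + (\<Sum>i\<in>I - {n}. k i)"
          "(\<Sum>i\<in>I. card (B i)) = card (B n) + (\<Sum>i\<in>I - {n}. card (B i))"
          using sum.remove[OF finI nI] by blast+
        moreover have "(\<Sum>i\<in>I. k i) = FS m" using k by blast
        moreover have "(\<Sum>j=1..m-1. int (h j n)) = int (\<Sum>j=1..r. h j n)" by (simp add: m)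
        ultimately show ?thesis
          using le[OF nI] card_PU[OF n] sum_card_B
          unfolding atLeastAtMost_iff max.bounded_iff min.bounded_iff by (intro conjI; linarith)
      qed
      have "(\<Sum>n=1..N. k n) + k (N+1) = FS m" using k unfolding I by simp
      moreover have "k (N+1) + (\<Sum>j=1..m-1. h j (N+1)) \<le> Ff"
        using le[of "N+1"] card_free by (simp add: m I_def)
      ultimately show "k \<in> ?R" using k bounds by blast
    next
      fix k assume k: "k \<in> ?R"
      \<comment> \<open>The upper interval ends, together with the free bound, say that no colour is
        overdrawn. Working in \<open>int\<close> keeps the difference from being truncated.\<close>
      have "k n + (\<Sum>j=1..r. h j n) \<le> card (B n)" if n: "n \<in> {1..N}" for n
      proof -
        have "int (k n) \<le> int (FP n) - int (\<Sum>j=1..r. h j n)"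
          using k n by (simp add: m)
        thus ?thesis using card_PU[OF n] by linarith
      qed
      moreover have "k (N+1) + (\<Sum>j=1..r. h j (N+1)) \<le> card (B (N+1))"
        unfolding card_free using k by (simp add: m)
      moreover have "(\<Sum>i\<in>I. k i) = FS m"
        unfolding I using k by simp
      ultimately show "k \<in> ?L"
        using k unfolding I by blast
    qed
    finally show ?thesis .
  qed
  ultimately show ?thesis by blast
qed

end
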